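(* Let $\psi:\mathfrak n^+\to\mathbb C$ be a Lie algebra homomorphism with $\psi(d_1)\neq0$ and $\psi(d_2)\neq0$, and write $\psi_i=\psi(d_i)$ for $i>0$. Suppose that $V$ is a Whittaker module of type $\psi$ for $\mathcal V$ such that $z\in\mathcal V$ acts on $V$ by the scalar $\xi\in\mathbb C$. Then $V$ is simple. Moreover, if $w$ is a cyclic Whittaker vector for $V$, then $$\mathrm{Ann}_{U(\mathcal V)}(w)=U(\mathcal V)(z-\xi 1)+\sum_{i>0}U(\mathcal V)(d_i-\psi_i 1).$$
   Context: The Virasoro algebra is the complex Lie algebra $\mathcal V$ with basis $\{z\}\cup\{d_k : k\in\mathbb Z\}$ and bracket $[d_k,d_j]=(j-k)d_{k+j}+\delta_{j,-k}\frac{k^3-k}{12}z$, $[z,d_k]=0$; $U(\mathcal V)$ denotes its universal enveloping algebra. Let $\mathfrak n^+=\mathrm{span}_{\mathbb C}\{d_1,d_2,\dots\}$. For a $\mathcal V$-module $V$, a vector $w\in V$ is a Whittaker vector (of type $\psi$) if $xw=\psi(x)w$ for all $x\in\mathfrak n^+$; $V$ is a Whittaker module of type $\psi$ if there is a Whittaker vector $w\in V$ of type $\psi$ which generates $V$ as a $\mathcal V$-module, and such a $w$ is called a cyclic Whittaker vector. $\mathrm{Ann}_{U(\mathcal V)}(w)=\{u\in U(\mathcal V): uw=0\}$. *)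

theory Defs
  imports Complex_Main "HOL-Library.Poly_Mapping"
begin

section \<open>Finitely supported families of complex numbers\<close>

definition smult_fs :: "complex \<Rightarrow> ('a \<Rightarrow>\<^sub>0 complex) \<Rightarrow> ('a \<Rightarrow>\<^sub>0 complex)" where
  "smult_fs c p = Poly_Mapping.map ((*) c) p"

lemma lookup_smult_fs [simp]: "Poly_Mapping.lookup (smult_fs c p) k = c * Poly_Mapping.lookup p k"
  by (simp add: smult_fs_def Poly_Mapping.map.rep_eq when_def)

lemma vector_space_smult_fs: "vector_space smult_fs"
  by unfold_locales (auto intro!: poly_mapping_eqI simp: lookup_add algebra_simps)

lemma fs_induct [case_names zero single add]:
  fixes p :: "'a \<Rightarrow>\<^sub>0 complex"
  assumes "P 0" "\<And>k c. P (Poly_Mapping.single k c)" "\<And>p q. P p \<Longrightarrow> P q \<Longrightarrow> P (p + q)"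
  shows "P p"
proof (induction p rule: update_induct)
  case const
  show ?case by (fact assms(1))
next
  case (update f a b)
  have "Poly_Mapping.update a b f = f + Poly_Mapping.single a b"
    using update(1)
    by (intro poly_mapping_eqI) (auto simp: lookup_update lookup_add lookup_single when_def in_keys_iff)
  then show ?case using update assms by metis
qed


section \<open>Lie algebras\<close>

locale lie_algebra = vector_space scale
  for scale :: "complex \<Rightarrow> 'g::ab_group_add \<Rightarrow> 'g" +
  fixes bracket :: "'g \<Rightarrow> 'g \<Rightarrow> 'g"
  assumes bracket_add_left: "bracket (x + y) w = bracket x w + bracket y w"
    and bracket_add_right: "bracket x (y + w) = bracket x y + bracket x w"
    and bracket_scale_left: "bracket (scale c x) y = scale c (bracket x y)"
    and bracket_scale_right: "bracket x (scale c y) = scale c (bracket x y)"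
    and bracket_alternating: "bracket x x = 0"
    and jacobi: "bracket x (bracket y w) + bracket y (bracket w x) + bracket w (bracket x y) = 0"
begin

definition lie_subalgebra :: "'g set \<Rightarrow> bool" where
  "lie_subalgebra A \<longleftrightarrow> subspace A \<and> (\<forall>x\<in>A. \<forall>y\<in>A. bracket x y \<in> A)"

text \<open>Homomorphisms from the subalgebra \<open>A\<close> to the Lie algebra of complex numbers, whose
  bracket is zero. The values of \<open>f\<close> outside \<open>A\<close> are irrelevant.\<close>

definition hom_to_complex :: "'g set \<Rightarrow> ('g \<Rightarrow> complex) \<Rightarrow> bool" where
  "hom_to_complex A f \<longleftrightarrow>
     (\<forall>x\<in>A. \<forall>y\<in>A. f (x + y) = f x + f y) \<and>
     (\<forall>c. \<forall>x\<in>A. f (scale c x) = c * f x) \<and>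
     (\<forall>x\<in>A. \<forall>y\<in>A. f (bracket x y) = 0)"

end


section \<open>The Virasoro algebra\<close>

datatype vir_basis = Cen | Dgen int

type_synonym vir = "vir_basis \<Rightarrow>\<^sub>0 complex"

definition vir_z :: vir where "vir_z = Poly_Mapping.single Cen 1"

definition vir_d :: "int \<Rightarrow> vir" where "vir_d k = Poly_Mapping.single (Dgen k) 1"

fun basis_bracket :: "vir_basis \<Rightarrow> vir_basis \<Rightarrow> vir" where
  "basis_bracket (Dgen k) (Dgen j) =
     smult_fs (of_int (j - k)) (vir_d (k + j)) +
     (if j = - k then smult_fs ((of_int k ^ 3 - of_int k) / 12) vir_z else 0)"
| "basis_bracket _ _ = 0"

definition vir_bracket :: "vir \<Rightarrow> vir \<Rightarrow> vir" where
  "vir_bracket x y =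
     (\<Sum>a\<in>Poly_Mapping.keys x. \<Sum>b\<in>Poly_Mapping.keys y.
        smult_fs (Poly_Mapping.lookup x a * Poly_Mapping.lookup y b) (basis_bracket a b))"

lemma keys_sum_extend:
  fixes f :: "'a \<Rightarrow> 'b::ab_group_add"
  assumes "finite S" "Poly_Mapping.keys x \<subseteq> S" "\<And>a. Poly_Mapping.lookup x a = 0 \<Longrightarrow> f a = 0"
  shows "(\<Sum>a\<in>Poly_Mapping.keys x. f a) = (\<Sum>a\<in>S. f a)"
  using assms by (intro sum.mono_neutral_left) (auto simp: in_keys_iff)

interpretation fs: vector_space smult_fs by (rule vector_space_smult_fs)

lemma vir_bracket_extend:
  assumes "finite S" "finite T" "Poly_Mapping.keys x \<subseteq> S" "Poly_Mapping.keys y \<subseteq> T"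
  shows "vir_bracket x y =
    (\<Sum>a\<in>S. \<Sum>b\<in>T. smult_fs (Poly_Mapping.lookup x a * Poly_Mapping.lookup y b) (basis_bracket a b))"
proof -
  have "vir_bracket x y =
    (\<Sum>a\<in>Poly_Mapping.keys x. \<Sum>b\<in>T. smult_fs (Poly_Mapping.lookup x a * Poly_Mapping.lookup y b) (basis_bracket a b))"
    unfolding vir_bracket_def using assms by (intro sum.cong keys_sum_extend) auto
  also have "\<dots> = (\<Sum>a\<in>S. \<Sum>b\<in>T. smult_fs (Poly_Mapping.lookup x a * Poly_Mapping.lookup y b) (basis_bracket a b))"
    using assms by (intro keys_sum_extend) auto
  finally show ?thesis .
qed

lemma vir_bracket_add_left: "vir_bracket (x + y) w = vir_bracket x w + vir_bracket y w"
proof -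
  let ?S = "Poly_Mapping.keys x \<union> Poly_Mapping.keys y"
  have *: "Poly_Mapping.keys (x + y) \<subseteq> ?S" by (rule Poly_Mapping.keys_add)
  show ?thesis
    by (subst (1 2 3) vir_bracket_extend[where S="?S" and T="Poly_Mapping.keys w"])
       (use * in \<open>auto simp: lookup_add ring_distribs fs.scale_left_distrib sum.distrib\<close>)
qed

lemma vir_bracket_add_right: "vir_bracket w (x + y) = vir_bracket w x + vir_bracket w y"
proof -
  let ?S = "Poly_Mapping.keys x \<union> Poly_Mapping.keys y"
  have *: "Poly_Mapping.keys (x + y) \<subseteq> ?S" by (rule Poly_Mapping.keys_add)
  show ?thesis
    by (subst (1 2 3) vir_bracket_extend[where T="?S" and S="Poly_Mapping.keys w"])
       (use * in \<open>auto simp: lookup_add ring_distribs fs.scale_left_distrib sum.distrib\<close>)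
qed

lemma keys_smult_fs: "Poly_Mapping.keys (smult_fs c x) \<subseteq> Poly_Mapping.keys x"
  by (auto simp: in_keys_iff)

lemma vir_bracket_scale_left: "vir_bracket (smult_fs c x) y = smult_fs c (vir_bracket x y)"
  by (subst (1 2) vir_bracket_extend[where S="Poly_Mapping.keys x" and T="Poly_Mapping.keys y"])
     (auto simp: keys_smult_fs fs.scale_sum_right mult_ac)

lemma vir_bracket_scale_right: "vir_bracket x (smult_fs c y) = smult_fs c (vir_bracket x y)"
  by (subst (1 2) vir_bracket_extend[where S="Poly_Mapping.keys x" and T="Poly_Mapping.keys y"])
     (auto simp: keys_smult_fs fs.scale_sum_right mult_ac)

lemma single_conv_smult: "Poly_Mapping.single a c = smult_fs c (Poly_Mapping.single a 1)"
  by (rule poly_mapping_eqI) (auto simp: lookup_single when_def)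

lemma vir_bracket_basis [simp]:
  "vir_bracket (Poly_Mapping.single a 1) (Poly_Mapping.single b 1) = basis_bracket a b"
  by (simp add: vir_bracket_def)

lemma vir_bracket_zero [simp]: "vir_bracket 0 x = 0" "vir_bracket x 0 = 0"
  by (simp_all add: vir_bracket_def)

lemma vir_bracket_d_d:
  "vir_bracket (vir_d k) (vir_d j) = smult_fs (of_int (j - k)) (vir_d (k + j)) +
     (if j = - k then smult_fs ((of_int k ^ 3 - of_int k) / 12) vir_z else 0)"
  by (simp add: vir_d_def)

lemma vir_bracket_z [simp]: "vir_bracket vir_z x = 0"
proof -
  have "basis_bracket Cen b = 0" for b by (cases b) auto
  then show ?thesis by (simp add: vir_bracket_def vir_z_def)
qed

lemma basis_bracket_anti: "basis_bracket a b = - basis_bracket b a"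
proof (cases a; cases b)
  fix i j assume [simp]: "a = Dgen i" "b = Dgen j"
  show ?thesis
  proof (cases "j = - i")
    case True
    then show ?thesis
      by (intro poly_mapping_eqI)
         (auto simp add: lookup_add lookup_minus lookup_single when_def vir_d_def vir_z_def diff_divide_distrib)
  next
    case False
    then have "i \<noteq> - j" by simp
    with False show ?thesis
      by (intro poly_mapping_eqI)
         (simp add: lookup_add lookup_single when_def vir_d_def vir_z_def add.commute)
  qed
qed auto

lemma vir_bracket_anti: "vir_bracket x y = - vir_bracket y x"
proof -
  have "vir_bracket x y = 
     (\<Sum>b\<in>Poly_Mapping.keys y. \<Sum>a\<in>Poly_Mapping.keys x. smult_fs (Poly_Mapping.lookup x a * Poly_Mapping.lookup y b) (basis_bracket a b))"
    unfolding vir_bracket_def by (rule sum.swap)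
  also have "\<dots> = - vir_bracket y x"
    unfolding vir_bracket_def
    by (subst basis_bracket_anti) (simp add: fs.scale_minus_right sum_negf mult.commute)
  finally show ?thesis .
qed

lemma vir_bracket_z_right [simp]: "vir_bracket x vir_z = 0"
  using vir_bracket_anti[of x vir_z] by simp

lemma vir_bracket_d_d_d:
  "vir_bracket (vir_d i) (vir_bracket (vir_d j) (vir_d k)) =
     smult_fs (of_int ((k - j) * (j + k - i))) (vir_d (i + j + k)) +
     smult_fs (if i + j + k = 0 then of_int (k - j) * (of_int i ^ 3 - of_int i) / 12 else 0) vir_z"
proof -
  have "j + k = - i \<longleftrightarrow> i + j + k = 0" by auto
  then show ?thesis
    by (simp add: vir_bracket_d_d vir_bracket_add_right vir_bracket_scale_right
          fs.scale_right_distrib add.assoc )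
qed

lemma vir_jacobi_basis:
  fixes a b c :: vir_basis
  defines "s \<equiv> (\<lambda>a. Poly_Mapping.single a (1::complex))"
  shows "vir_bracket (s a) (vir_bracket (s b) (s c)) + vir_bracket (s b) (vir_bracket (s c) (s a)) +
    vir_bracket (s c) (vir_bracket (s a) (s b)) = 0"
proof -
  have s: "s Cen = vir_z" "s (Dgen k) = vir_d k" for k
    by (simp_all add: s_def vir_z_def vir_d_def)
  show ?thesis
  proof (cases a; cases b; cases c)
    fix i j k assume [simp]: "a = Dgen i" "b = Dgen j" "c = Dgen k"
    have perm: "j + k + i = i + j + k" "k + i + j = i + j + k" by simp_all
    have 1: "(k - j) * (j + k - i) + (i - k) * (k + i - j) + (j - i) * (i + j - k) = 0"
      by (simp add: algebra_simps)
    have 2: "of_int (k - j) * (of_int i ^ 3 - of_int i) / 12 +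
        of_int (i - k) * (of_int j ^ 3 - of_int j) / 12 +
        of_int (j - i) * (of_int k ^ 3 - of_int k) / (12 :: complex) = 0"
      if "i + j + k = 0"
    proof -
      have k: "k = - i - j" using that by simp
      show ?thesis unfolding k by (simp add: algebra_simps power3_eq_cube add_divide_distrib diff_divide_distrib)
    qed
    let ?A = "\<lambda>i j k. of_int ((k - j) * (j + k - i)) :: complex"
    let ?B = "\<lambda>i j k. (if i + j + k = 0 then of_int (k - j) * (of_int i ^ 3 - of_int i) / 12 else 0) :: complex"
    have "vir_bracket (s a) (vir_bracket (s b) (s c)) + vir_bracket (s b) (vir_bracket (s c) (s a)) +
        vir_bracket (s c) (vir_bracket (s a) (s b)) =
      smult_fs (?A i j k + ?A j k i + ?A k i j) (vir_d (i + j + k)) +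
      smult_fs (?B i j k + ?B j k i + ?B k i j) vir_z"
      by (simp only: s \<open>a = Dgen i\<close> \<open>b = Dgen j\<close> \<open>c = Dgen k\<close> vir_bracket_d_d_d
            perm fs.scale_left_distrib ac_simps)
    also have "?A i j k + ?A j k i + ?A k i j = 0"
      using 1 unfolding of_int_add[symmetric] by simp
    also have "?B i j k + ?B j k i + ?B k i j = 0"
      using 2 perm by simp
    finally show ?thesis by simp
  qed (simp_all add: s)
qed

lemma vir_jacobi:
  "vir_bracket x (vir_bracket y w) + vir_bracket y (vir_bracket w x) +
    vir_bracket w (vir_bracket x y) = 0"
proof -
  define J where "J x y w = vir_bracket x (vir_bracket y w) + vir_bracket y (vir_bracket w x) +
    vir_bracket w (vir_bracket x y)" for x y w
  have zero: "J 0 y w = 0" "J x 0 w = 0" "J x y 0 = 0" for x y w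
    by (simp_all add: J_def)
  have add: "J (x + x') y w = J x y w + J x' y w" "J x (y + y') w = J x y w + J x y' w"
    "J x y (w + w') = J x y w + J x y w'" for x x' y y' w w'
    by (simp_all add: J_def vir_bracket_add_left vir_bracket_add_right)
  have scale: "J (smult_fs c x) y w = smult_fs c (J x y w)"
    "J x (smult_fs c y) w = smult_fs c (J x y w)" "J x y (smult_fs c w) = smult_fs c (J x y w)"
    for x y w c
    by (simp_all only: J_def vir_bracket_scale_left vir_bracket_scale_right fs.scale_right_distrib)
  have basis: "J (Poly_Mapping.single a 1) (Poly_Mapping.single b 1) (Poly_Mapping.single c 1) = 0"
    for a b c
    unfolding J_def by (rule vir_jacobi_basis)
  have 1: "J (Poly_Mapping.single a 1) (Poly_Mapping.single b 1) w = 0" for a b w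
  proof (induction w rule: fs_induct)
    case (single k c)
    show ?case by (subst single_conv_smult) (simp only: scale basis fs.scale_zero_right)
  qed (simp_all add: zero add)
  have 2: "J (Poly_Mapping.single a 1) y w = 0" for a y w
  proof (induction y rule: fs_induct)
    case (single k c)
    show ?case by (subst single_conv_smult[of k c]) (simp only: scale 1 fs.scale_zero_right)
  qed (simp_all add: zero add)
  have "J x y w = 0"
  proof (induction x rule: fs_induct)
    case (single k c)
    show ?case by (subst single_conv_smult[of k c]) (simp only: scale 2 fs.scale_zero_right)
  qed (simp_all add: zero add)
  then show ?thesis by (simp add: J_def)
qed

interpretation vir: lie_algebra smult_fs vir_bracket
proof unfold_locales
  fix x y w :: vir
  have "vir_bracket x x = - vir_bracket x x" by (rule vir_bracket_anti)
  then have "Poly_Mapping.lookup (vir_bracket x x) k = - Poly_Mapping.lookup (vir_bracket x x) k" for k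
    by (metis lookup_uminus)
  then show "vir_bracket x x = 0"
    by (intro poly_mapping_eqI) simp
qed (fact vir_bracket_add_left vir_bracket_add_right vir_bracket_scale_left
      vir_bracket_scale_right vir_jacobi)+

definition n_plus :: "vir set" where
  "n_plus = fs.span {vir_d k | k. k \<ge> 1}"

lemma vir_d_in_n_plus: "k \<ge> 1 \<Longrightarrow> vir_d k \<in> n_plus"
  unfolding n_plus_def by (intro fs.span_base) blast

lemma lie_subalgebra_n_plus: "vir.lie_subalgebra n_plus"
proof -
  have sub: "fs.subspace n_plus" by (simp add: n_plus_def)
  have 1: "vir_bracket (vir_d i) y \<in> n_plus" if "i \<ge> 1" "y \<in> n_plus" for i y
    using that(2) unfolding n_plus_def
  proof (induction rule: fs.span_induct_alt)
    case base
    show ?case by (simp add: fs.span_zero)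
  next
    case (step c x y)
    then obtain j where j: "j \<ge> 1" "x = vir_d j" by blast
    then have "vir_bracket (vir_d i) x = smult_fs (of_int (j - i)) (vir_d (i + j))"
      using that(1) by (simp add: vir_bracket_d_d)
    moreover have "vir_d (i + j) \<in> n_plus"
      using j(1) that(1) by (intro vir_d_in_n_plus) simp
    ultimately have "vir_bracket (vir_d i) x \<in> fs.span {vir_d k | k. k \<ge> 1}"
      unfolding n_plus_def by (simp only: fs.span_scale)
    with step.IH show ?case
      unfolding vir_bracket_add_right vir_bracket_scale_right
      by (intro fs.span_add fs.span_scale)
  qed
  have 2: "vir_bracket x y \<in> n_plus" if "x \<in> n_plus" "y \<in> n_plus" for x y
    using that(1) unfolding n_plus_def
  proof (induction rule: fs.span_induct_alt)
    case base
    show ?case by (simp add: fs.span_zero)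
  next
    case (step c u v)
    then have "vir_bracket u y \<in> fs.span {vir_d k | k. k \<ge> 1}"
      using 1 that(2) unfolding n_plus_def by blast
    with step.IH show ?case
      unfolding vir_bracket_add_left vir_bracket_scale_left
      by (intro fs.span_add fs.span_scale)
  qed
  show ?thesis using sub 2 by (simp add: vir.lie_subalgebra_def)
qed


section \<open>The tensor algebra and Virasoro modules\<close>

text \<open>The free monoid on a set, written additively because the convolution product of
  \<^typ>\<open>'a \<Rightarrow>\<^sub>0 'b\<close> uses the addition of the index type.\<close>

datatype 'a free_monoid = Word (letters: "'a list")

instantiation free_monoid :: (type) monoid_add
begin
definition zero_free_monoid :: "'a free_monoid" where "0 = Word []"
definition plus_free_monoid :: "'a free_monoid \<Rightarrow> 'a free_monoid \<Rightarrow> 'a free_monoid" where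
  "v + w = Word (letters v @ letters w)"
instance by standard (simp_all add: zero_free_monoid_def plus_free_monoid_def)
end

text \<open>The tensor algebra of \<^typ>\<open>vir\<close>: its basis of words in the basis elements corresponds
  to the pure tensors of basis elements, and the product is concatenation.\<close>

type_synonym vir_tensor = "vir_basis free_monoid \<Rightarrow>\<^sub>0 complex"

definition tensor_gen :: "vir \<Rightarrow> vir_tensor" where
  "tensor_gen x = (\<Sum>a\<in>Poly_Mapping.keys x. Poly_Mapping.single (Word [a]) (Poly_Mapping.lookup x a))"

text \<open>The two-sided ideal generated by the elements
  \<open>x \<otimes> y - y \<otimes> x - [x, y]\<close>.\<close>

inductive_set env_ideal :: "vir_tensor set" where
  zero: "0 \<in> env_ideal"
| gen: "p * (tensor_gen x * tensor_gen y - tensor_gen y * tensor_gen x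
          - tensor_gen (vir_bracket x y)) * q \<in> env_ideal"
| add: "p \<in> env_ideal \<Longrightarrow> q \<in> env_ideal \<Longrightarrow> p + q \<in> env_ideal"

lemma env_ideal_mult_left: "p \<in> env_ideal \<Longrightarrow> r * p \<in> env_ideal"
proof (induction rule: env_ideal.induct)
  case (gen p x y q)
  show ?case using env_ideal.gen[of "r * p" x y q] by (simp add: mult.assoc)
qed (auto intro: env_ideal.intros simp: distrib_left)

lemma env_ideal_mult_right: "p \<in> env_ideal \<Longrightarrow> p * r \<in> env_ideal"
proof (induction rule: env_ideal.induct)
  case (gen p x y q)
  show ?case using env_ideal.gen[of p x y "q * r"] by (simp add: mult.assoc)
qed (auto intro: env_ideal.intros simp: distrib_right)

lemma env_ideal_uminus: "p \<in> env_ideal \<Longrightarrow> - p \<in> env_ideal"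
  using env_ideal_mult_left[of p "- 1"] by simp

lemma env_ideal_diff: "p \<in> env_ideal \<Longrightarrow> q \<in> env_ideal \<Longrightarrow> p - q \<in> env_ideal"
  using env_ideal.add[OF _ env_ideal_uminus, of p q] by simp

lemma smult_fs_tensor: "smult_fs c (p :: vir_tensor) = Poly_Mapping.single 0 c * p"
  by (simp add: smult_fs_def mult_map_scale_conv_mult)

lemma env_ideal_smult: "p \<in> env_ideal \<Longrightarrow> smult_fs c p \<in> env_ideal"
  by (simp add: smult_fs_tensor env_ideal_mult_left)

locale vir_module = vector_space scale
  for scale :: "complex \<Rightarrow> 'v::ab_group_add \<Rightarrow> 'v" +
  fixes act :: "vir \<Rightarrow> 'v \<Rightarrow> 'v"
  assumes act_add_left: "act (x + y) v = act x v + act y v"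
    and act_smult_left: "act (smult_fs c x) v = scale c (act x v)"
    and act_add_right: "act x (v + w) = act x v + act x w"
    and act_scale_right: "act x (scale c v) = scale c (act x v)"
    and act_bracket: "act (vir_bracket x y) v = act x (act y v) - act y (act x v)"
begin

definition submodule :: "'v set \<Rightarrow> bool" where
  "submodule W \<longleftrightarrow> subspace W \<and> (\<forall>x. \<forall>v\<in>W. act x v \<in> W)"

definition simple :: bool where
  "simple \<longleftrightarrow> (\<exists>v::'v. v \<noteq> 0) \<and> (\<forall>W. submodule W \<longrightarrow> W = {0} \<or> W = UNIV)"

definition generates :: "'v \<Rightarrow> bool" where
  "generates w \<longleftrightarrow> (\<forall>W. submodule W \<and> w \<in> W \<longrightarrow> W = UNIV)"

definition whittaker_vector :: "(vir \<Rightarrow> complex) \<Rightarrow> 'v \<Rightarrow> bool" where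
  "whittaker_vector \<psi> w \<longleftrightarrow> (\<forall>x\<in>n_plus. act x w = scale (\<psi> x) w)"

definition cyclic_whittaker_vector :: "(vir \<Rightarrow> complex) \<Rightarrow> 'v \<Rightarrow> bool" where
  "cyclic_whittaker_vector \<psi> w \<longleftrightarrow> whittaker_vector \<psi> w \<and> generates w"

definition whittaker_module :: "(vir \<Rightarrow> complex) \<Rightarrow> bool" where
  "whittaker_module \<psi> \<longleftrightarrow> (\<exists>w. cyclic_whittaker_vector \<psi> w)"

definition word_act :: "vir_basis free_monoid \<Rightarrow> 'v \<Rightarrow> 'v" where
  "word_act m v = foldr (\<lambda>a. act (Poly_Mapping.single a 1)) (letters m) v"

definition tensor_act :: "vir_tensor \<Rightarrow> 'v \<Rightarrow> 'v" where
  "tensor_act p v = (\<Sum>m\<in>Poly_Mapping.keys p. scale (Poly_Mapping.lookup p m) (word_act m v))"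

lemma act_zero_left [simp]: "act 0 v = 0"
  using act_add_left[of 0 0 v] by simp

lemma act_zero_right [simp]: "act x 0 = 0"
  using act_add_right[of x 0 0] by simp

lemma word_act_zero [simp]: "word_act 0 v = v"
  by (simp add: word_act_def zero_free_monoid_def)

lemma word_act_plus: "word_act (m + n) v = word_act m (word_act n v)"
  by (simp add: word_act_def plus_free_monoid_def)

lemma word_act_add: "word_act m (v + w) = word_act m v + word_act m w"
proof -
  have "foldr (\<lambda>a. act (Poly_Mapping.single a 1)) l (v + w) =
    foldr (\<lambda>a. act (Poly_Mapping.single a 1)) l v + foldr (\<lambda>a. act (Poly_Mapping.single a 1)) l w" for l
    by (induction l) (simp_all add: act_add_right)
  then show ?thesis by (simp add: word_act_def)
qed

lemma word_act_scale: "word_act m (scale c v) = scale c (word_act m v)"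
proof -
  have "foldr (\<lambda>a. act (Poly_Mapping.single a 1)) l (scale c v) =
    scale c (foldr (\<lambda>a. act (Poly_Mapping.single a 1)) l v)" for l
    by (induction l) (simp_all add: act_scale_right)
  then show ?thesis by (simp add: word_act_def)
qed

lemma tensor_act_zero [simp]: "tensor_act 0 v = 0"
  by (simp add: tensor_act_def)

lemma tensor_act_single [simp]:
  "tensor_act (Poly_Mapping.single m c) v = scale c (word_act m v)"
  by (simp add: tensor_act_def)

lemma tensor_act_add: "tensor_act (p + q) v = tensor_act p v + tensor_act q v"
  unfolding tensor_act_def
  by (rule setsum_keys_plus_distrib[where f = "\<lambda>m c. scale c (word_act m v)"])
     (simp_all add: scale_left_distrib)

lemma tensor_act_uminus: "tensor_act (- p) v = - tensor_act p v"
  using tensor_act_add[of p "- p" v] by (simp add: eq_neg_iff_add_eq_0 add.commute)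

lemma tensor_act_diff: "tensor_act (p - q) v = tensor_act p v - tensor_act q v"
  using tensor_act_add[of p "- q" v] by (simp add: tensor_act_uminus)

lemma tensor_act_sum: "tensor_act (\<Sum>i\<in>I. f i) v = (\<Sum>i\<in>I. tensor_act (f i) v)"
  by (induction I rule: infinite_finite_induct) (simp_all add: tensor_act_add)

lemma tensor_act_add_right: "tensor_act p (v + w) = tensor_act p v + tensor_act p w"
  by (simp add: tensor_act_def word_act_add scale_right_distrib sum.distrib)

lemma tensor_act_scale_right: "tensor_act p (scale c v) = scale c (tensor_act p v)"
  by (simp add: tensor_act_def word_act_scale scale_sum_right mult.commute)

lemma tensor_act_zero_right [simp]: "tensor_act p 0 = 0"
  using tensor_act_scale_right[of p 0 0] by simp

lemma tensor_act_mult: "tensor_act (p * q) v = tensor_act p (tensor_act q v)"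
proof (induction p rule: fs_induct)
  case (single k c)
  show ?case
  proof (induction q rule: fs_induct)
    case (single l d)
    show ?case by (simp add: mult_single word_act_plus word_act_scale)
  next
    case (add p q)
    then show ?case
      by (simp add: distrib_left tensor_act_add word_act_add scale_right_distrib)
  qed (simp add: word_act_scale[of k 0 0, simplified])
qed (simp_all add: distrib_right tensor_act_add)

lemma tensor_act_one: "tensor_act 1 v = v"
  using tensor_act_single[of 0 1 v] by simp

lemma tensor_act_smult: "tensor_act (smult_fs c p) v = scale c (tensor_act p v)"
  by (simp add: smult_fs_tensor tensor_act_mult)

lemma act_sum_left: "act (\<Sum>i\<in>I. f i) v = (\<Sum>i\<in>I. act (f i) v)"
  by (induction I rule: infinite_finite_induct) (simp_all add: act_add_left)

lemma tensor_act_gen [simp]: "tensor_act (tensor_gen x) v = act x v"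
proof -
  have "tensor_act (tensor_gen x) v =
      (\<Sum>a\<in>Poly_Mapping.keys x. act (smult_fs (Poly_Mapping.lookup x a) (Poly_Mapping.single a 1)) v)"
    by (simp add: tensor_gen_def tensor_act_sum word_act_def act_smult_left)
  also have "\<dots> = act (\<Sum>a\<in>Poly_Mapping.keys x. smult_fs (Poly_Mapping.lookup x a) (Poly_Mapping.single a 1)) v"
    by (simp add: act_sum_left)
  also have "(\<Sum>a\<in>Poly_Mapping.keys x. smult_fs (Poly_Mapping.lookup x a) (Poly_Mapping.single a 1)) = x"
    by (rule poly_mapping_eqI)
       (auto simp: lookup_sum lookup_single when_def in_keys_iff if_distrib cong: if_cong)
  finally show ?thesis .
qed

lemma tensor_act_env_ideal: "p \<in> env_ideal \<Longrightarrow> tensor_act p v = 0"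
  by (induction rule: env_ideal.induct)
     (simp_all add: tensor_act_add tensor_act_mult tensor_act_diff act_bracket)

end


section \<open>The universal enveloping algebra\<close>

quotient_type vir_env = vir_tensor / "\<lambda>p q. p - q \<in> env_ideal"
proof (rule equivpI)
  show "reflp (\<lambda>p q. p - q \<in> env_ideal)"
    by (rule reflpI) (simp add: env_ideal.zero)
  show "symp (\<lambda>p q. p - q \<in> env_ideal)"
    by (rule sympI) (metis env_ideal_uminus minus_diff_eq)
  show "transp (\<lambda>p q. p - q \<in> env_ideal)"
  proof (rule transpI)
    fix p q r :: vir_tensor assume "p - q \<in> env_ideal" "q - r \<in> env_ideal"
    then have "(p - q) + (q - r) \<in> env_ideal" by (rule env_ideal.add)
    then show "p - r \<in> env_ideal" by simp
  qed
qed

lemma one_notin_env_ideal: "1 \<notin> env_ideal"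
proof
  interpret triv: vir_module "(*) :: complex \<Rightarrow> complex \<Rightarrow> complex" "\<lambda>_ _. 0"
    by unfold_locales (simp_all add: algebra_simps)
  assume "1 \<in> env_ideal"
  then have "triv.tensor_act 1 1 = 0" by (rule triv.tensor_act_env_ideal)
  with triv.tensor_act_one[of 1] show False by (metis one_neq_zero)
qed

instantiation vir_env :: ring_1
begin

lift_definition zero_vir_env :: vir_env is 0 .

lift_definition one_vir_env :: vir_env is 1 .

lift_definition plus_vir_env :: "vir_env \<Rightarrow> vir_env \<Rightarrow> vir_env" is "(+)"
proof -
  fix p p' q q' :: vir_tensor assume "p - p' \<in> env_ideal" "q - q' \<in> env_ideal"
  then have "(p - p') + (q - q') \<in> env_ideal" by (rule env_ideal.add)
  then show "(p + q) - (p' + q') \<in> env_ideal" by (simp add: algebra_simps)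
qed

lift_definition uminus_vir_env :: "vir_env \<Rightarrow> vir_env" is uminus
proof -
  fix p p' :: vir_tensor assume "p - p' \<in> env_ideal"
  then show "- p - - p' \<in> env_ideal" using env_ideal_uminus by fastforce
qed

lift_definition minus_vir_env :: "vir_env \<Rightarrow> vir_env \<Rightarrow> vir_env" is "(-)"
proof -
  fix p p' q q' :: vir_tensor assume "p - p' \<in> env_ideal" "q - q' \<in> env_ideal"
  then have "(p - p') - (q - q') \<in> env_ideal" by (rule env_ideal_diff)
  then show "(p - q) - (p' - q') \<in> env_ideal" by (simp add: algebra_simps)
qed

lift_definition times_vir_env :: "vir_env \<Rightarrow> vir_env \<Rightarrow> vir_env" is "(*)"
proof -
  fix p p' q q' :: vir_tensor assume "p - p' \<in> env_ideal" "q - q' \<in> env_ideal"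
  then have "(p - p') * q + p' * (q - q') \<in> env_ideal"
    by (intro env_ideal.add env_ideal_mult_left env_ideal_mult_right)
  then show "p * q - p' * q' \<in> env_ideal" by (simp add: algebra_simps)
qed

instance
proof
  show "(0::vir_env) \<noteq> 1"
    by transfer (use one_notin_env_ideal env_ideal_uminus[of "- 1"] in auto)
qed (transfer, simp add: algebra_simps env_ideal.zero)+

end

lift_definition env_scale :: "complex \<Rightarrow> vir_env \<Rightarrow> vir_env" is smult_fs
  using env_ideal_smult fs.scale_right_diff_distrib by metis

lift_definition env_gen :: "vir \<Rightarrow> vir_env" is tensor_gen .

context vir_module
begin

text \<open>The value does not depend on the chosen representative: see \<open>env_act_abs\<close> below.
  This is the unique unital action of the enveloping algebra extending \<open>act\<close>.\<close>

definition env_act :: "vir_env \<Rightarrow> 'v \<Rightarrow> 'v" where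
  "env_act u v = tensor_act (rep_vir_env u) v"

definition annihilator :: "'v \<Rightarrow> vir_env set" where
  "annihilator w = {u. env_act u w = 0}"

lemma env_act_abs: "env_act (abs_vir_env p) v = tensor_act p v"
proof -
  have "rep_vir_env (abs_vir_env p) - p \<in> env_ideal"
    using Quotient3_rep_abs[OF Quotient3_vir_env, of p] env_ideal.zero by simp
  then have "tensor_act (rep_vir_env (abs_vir_env p) - p) v = 0"
    by (rule tensor_act_env_ideal)
  then show ?thesis by (simp add: env_act_def tensor_act_diff)
qed

lemma env_act_gen [simp]: "env_act (env_gen x) v = act x v"
  by (simp add: env_gen.abs_eq env_act_abs)

lemma env_act_one [simp]: "env_act 1 v = v"
  by (simp add: one_vir_env.abs_eq env_act_abs tensor_act_one)

lemma env_act_mult: "env_act (a * b) v = env_act a (env_act b v)"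
  by (induction a, induction b) (simp add: times_vir_env.abs_eq env_act_abs tensor_act_mult)

lemma env_act_add: "env_act (a + b) v = env_act a v + env_act b v"
  by (induction a, induction b) (simp add: plus_vir_env.abs_eq env_act_abs tensor_act_add)

lemma env_act_diff: "env_act (a - b) v = env_act a v - env_act b v"
  by (induction a, induction b) (simp add: minus_vir_env.abs_eq env_act_abs tensor_act_diff)

lemma env_act_scale: "env_act (env_scale c a) v = scale c (env_act a v)"
  by (induction a) (simp add: env_scale.abs_eq env_act_abs tensor_act_smult)

lemma env_act_add_right: "env_act a (v + w) = env_act a v + env_act a w"
  by (simp add: env_act_def tensor_act_add_right)

lemma env_act_scale_right: "env_act a (scale c v) = scale c (env_act a v)"
  by (simp add: env_act_def tensor_act_scale_right)

end

end

theory Submission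
  imports Defs "HOL-Library.Multiset" "HOL-Library.Product_Lexorder"
begin

text \<open>Write \<open>U\<close> for the enveloping algebra and \<open>J\<close> for the left ideal generated by
  \<open>z - \<xi>\<close> and all \<open>d\<^sub>n - \<psi>\<^sub>n\<close> with \<open>n > 0\<close>. Everything follows from one property of \<open>J\<close>, lemma
  \<open>reach_one\<close>: for each \<open>u \<notin> J\<close> some left multiple of \<open>u\<close> is congruent modulo \<open>J\<close> to a nonzero scalar.
  Since \<open>J\<close> kills a cyclic Whittaker vector \<open>w\<close>, the vector \<open>u w\<close> then generates a nonzero
  multiple of \<open>w\<close>. As every vector has the form \<open>u w\<close>, each nonzero submodule contains \<open>w\<close>, which is
  simplicity; and \<open>u w = 0\<close> with \<open>u \<notin> J\<close> would force \<open>w = 0\<close>, so the annihilator of \<open>w\<close> is \<open>J\<close>.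

  To prove \<open>reach_one\<close>, attach to a multiset \<open>M\<close> of natural numbers the ordered product of the
  \<open>d\<^bsub>-k\<^esub>\<close> with \<open>k \<in># M\<close>. These monomials span \<open>U\<close> modulo \<open>J\<close> (lemma \<open>spanned_by_pbw\<close>). Order them by
  weight (the sum of \<open>M\<close>), then by length (the size of \<open>M\<close>). Because \<open>\<psi>\<^sub>n = 0\<close> for \<open>n \<ge> 3\<close>,
  multiplication by \<open>d\<^bsub>n+2\<^esub> - \<psi>\<^bsub>n+2\<^esub>\<close> acts modulo \<open>J\<close> and to leading order as the
  derivative with respect to \<open>d\<^bsub>-n\<^esub>\<close>, multiplied by the nonzero constant \<open>-(2n+2) \<psi>\<^sub>2\<close>: the
  commutator \<open>[d\<^bsub>n+2\<^esub>, d\<^bsub>-n\<^esub>] = -(2n+2) d\<^sub>2\<close> removes one factor and lowers the weight by \<open>n\<close>, whereas every other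
  contribution either lowers the weight by more than \<open>n\<close>, or lowers it by exactly \<open>n\<close> and the length by at least two (lemma \<open>lower_pbw\<close>).
  If \<open>d\<^bsub>-n\<^esub>\<close> occurs in the leading part of a combination of monomials, this derivative of the leading part is again nonzero,
  so iterating strips off all factors and ends in a nonzero scalar (lemma \<open>reach_one_of_leading\<close>).\<close>

section \<open>The enveloping algebra as an algebra over the complex numbers\<close>

interpretation env: vector_space env_scale
proof
  show "env_scale a (x + y) = env_scale a x + env_scale a y" for a x y
    by transfer (simp add: fs.scale_right_distrib env_ideal.zero)
  show "env_scale (a + b) x = env_scale a x + env_scale b x" for a b x
    by transfer (simp add: fs.scale_left_distrib env_ideal.zero)
  show "env_scale a (env_scale b x) = env_scale (a * b) x" for a b x
    by transfer (simp add: env_ideal.zero)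
  show "env_scale 1 x = x" for x
    by transfer (simp add: env_ideal.zero)
qed

lemma env_scale_mult_left: "env_scale c a * b = env_scale c (a * b)"
  by transfer (simp add: smult_fs_tensor mult.assoc env_ideal.zero)

lemma tensor_scalar_central:
  "p * Poly_Mapping.single 0 c = Poly_Mapping.single 0 c * (p :: vir_tensor)"
  by (induction p rule: fs_induct) (simp_all add: mult_single distrib_left distrib_right mult.commute)

lemma env_scale_mult_right: "a * env_scale c b = env_scale c (a * b)"
  by transfer (simp add: smult_fs_tensor mult.assoc[symmetric] tensor_scalar_central env_ideal.zero)

lemma tensor_gen_add: "tensor_gen (x + y) = tensor_gen x + tensor_gen y"
  unfolding tensor_gen_def
  by (rule setsum_keys_plus_distrib[where f = "\<lambda>a c. Poly_Mapping.single (Word [a]) c"])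
     (simp_all add: single_add)

lemma smult_fs_single: "smult_fs c (Poly_Mapping.single k b) = Poly_Mapping.single k (c * b)"
  by (rule poly_mapping_eqI) (simp add: lookup_single when_def)

lemma tensor_gen_smult: "tensor_gen (smult_fs c x) = smult_fs c (tensor_gen x)"
proof (induction x rule: fs_induct)
  case (single a b)
  have *: "tensor_gen (Poly_Mapping.single a d) = Poly_Mapping.single (Word [a]) d" for d
    by (simp add: tensor_gen_def)
  show ?case by (simp add: * smult_fs_single)
qed (simp_all add: fs.scale_right_distrib tensor_gen_add, simp add: tensor_gen_def)

lemma env_gen_add: "env_gen (x + y) = env_gen x + env_gen y"
  by (simp add: env_gen.abs_eq plus_vir_env.abs_eq tensor_gen_add)

lemma env_gen_smult: "env_gen (smult_fs c x) = env_scale c (env_gen x)"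
  by (simp add: env_gen.abs_eq env_scale.abs_eq tensor_gen_smult)

lemma env_gen_zero [simp]: "env_gen 0 = 0"
  using env_gen_smult[of 0 0] by simp

lemma env_gen_bracket: "env_gen x * env_gen y - env_gen y * env_gen x = env_gen (vir_bracket x y)"
  by transfer (use env_ideal.gen[of 1 _ _ 1] in simp)

lemma env_gen_z_central: "env_gen vir_z * env_gen x = env_gen x * env_gen vir_z"
  using env_gen_bracket[of vir_z x] by simp

lemma env_gen_d_commute:
  "env_gen (vir_d k) * env_gen (vir_d j) = env_gen (vir_d j) * env_gen (vir_d k) +
     env_scale (of_int (j - k)) (env_gen (vir_d (k + j))) +
     (if j = - k then env_scale ((of_int k ^ 3 - of_int k) / 12) (env_gen vir_z) else 0)"
  using env_gen_bracket[of "vir_d k" "vir_d j"]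
  unfolding diff_eq_eq vir_bracket_d_d env_gen_add env_gen_smult
  by (simp add: env_gen_smult add_ac)

text \<open>The basis elements of the Lie algebra generate \<open>U\<close>, so a subspace that contains \<open>1\<close> and is stable
  under left multiplication by them is all of \<open>U\<close>.\<close>

lemma env_induct [case_names one add scale gen]:
  assumes one: "P 1"
    and add: "\<And>a b. P a \<Longrightarrow> P b \<Longrightarrow> P (a + b)"
    and scale: "\<And>c a. P a \<Longrightarrow> P (env_scale c a)"
    and gen: "\<And>b a. P a \<Longrightarrow> P (env_gen (Poly_Mapping.single b 1) * a)"
  shows "P u"
proof -
  have word: "P (abs_vir_env (Poly_Mapping.single (Word l) 1))" for l
  proof (induction l)
    case Nil
    show ?case using one by (simp add: one_vir_env.abs_eq zero_free_monoid_def[symmetric])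
  next
    case (Cons b l)
    have "Word (b # l) = Word [b] + Word l"
      by (simp add: plus_free_monoid_def)
    then have "abs_vir_env (Poly_Mapping.single (Word (b # l)) 1) =
        env_gen (Poly_Mapping.single b 1) * abs_vir_env (Poly_Mapping.single (Word l) 1)"
      by (simp add: env_gen.abs_eq times_vir_env.abs_eq tensor_gen_def mult_single)
    then show ?case using gen[OF Cons.IH] by simp
  qed
  have "P (abs_vir_env p)" for p
  proof (induction p rule: fs_induct)
    case zero
    show ?case using scale[OF one, of 0] by (simp add: zero_vir_env.abs_eq)
  next
    case (single k c)
    obtain l where k: "k = Word l" by (cases k)
    show ?case using scale[OF word, of c l] 
      by (simp add: k env_scale.abs_eq single_conv_smult[symmetric])
  next
    case (add p q)
    then show ?case using assms(2) by (metis plus_vir_env.abs_eq)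
  qed
  then show ?thesis by (induction u) auto
qed

lemma mult_span_closed:
  assumes "u \<in> env.span S" "env.subspace T" "\<And>x. x \<in> S \<Longrightarrow> a * x \<in> T"
  shows "a * u \<in> T"
  using assms(1)
proof (induction rule: env.span_induct_alt)
  case base
  show ?case using assms(2) by (simp add: env.subspace_0)
next
  case (step c x y)
  then show ?case
    using assms(2,3) by (simp add: distrib_left env_scale_mult_right env.subspace_add env.subspace_scale)
qed

section \<open>Ordered monomials\<close>

definition pbw :: "nat multiset \<Rightarrow> vir_env" where
  "pbw M = prod_list (map (\<lambda>k. env_gen (vir_d (- int k))) (sorted_list_of_multiset M))"

text \<open>Weight before length: pairs of natural numbers carry the lexicographic order, which is a
  well-order.\<close>

definition deg :: "nat multiset \<Rightarrow> nat \<times> nat" where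
  "deg M = (sum_mset M, size M)"

lemma pbw_empty [simp]: "pbw {#} = 1"
  by (simp add: pbw_def)

lemma pbw_add_min:
  assumes "\<And>x. x \<in># M \<Longrightarrow> a \<le> x"
  shows "pbw (add_mset a M) = env_gen (vir_d (- int a)) * pbw M"
proof -
  have "sorted_list_of_multiset (add_mset a M) = a # sorted_list_of_multiset M"
    using assms by (simp add: insort_is_Cons)
  then show ?thesis by (simp add: pbw_def)
qed

lemma pbw_z_central: "env_gen vir_z * pbw M = pbw M * env_gen vir_z"
proof -
  have "env_gen vir_z * prod_list (map (\<lambda>k. env_gen (vir_d (- int k))) l) =
      prod_list (map (\<lambda>k. env_gen (vir_d (- int k))) l) * env_gen vir_z" for l
    by (induction l) (simp, simp, metis env_gen_z_central mult.assoc)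
  then show ?thesis by (simp add: pbw_def)
qed

text \<open>The weight \<open>s\<close> is fixed exactly. Reordering factors does not change the weight of a monomial, and
  keeping this information makes the result below usable both with the order by \<open>deg\<close> and with
  bounds on the weight alone.\<close>

definition pbw_span :: "nat \<Rightarrow> nat \<Rightarrow> vir_env set" where
  "pbw_span s l = env.span (pbw ` {M. sum_mset M = s \<and> size M \<le> l})"

text \<open>Sorting \<open>d\<^bsub>-k\<^esub>\<close> into its place costs only commutators \<open>[d\<^bsub>-k\<^esub>, d\<^bsub>-a\<^esub>] = (k - a) d\<^bsub>-(k+a)\<^esub>\<close>, each of which keeps the
  weight and merges two factors into one. The induction is on the length because, after \<open>d\<^bsub>-k\<^esub>\<close> has been moved past
  the first factor \<open>d\<^bsub>-a\<^esub>\<close>, that factor must in turn be sorted into the shorter error terms.\<close>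

lemma gen_mult_pbw:
  "env_gen (vir_d (- int k)) * pbw M - pbw (add_mset k M) \<in> pbw_span (sum_mset M + k) (size M)"
proof (induction "size M" arbitrary: k M rule: less_induct)
  case less
  show ?case
  proof (cases "\<forall>x\<in>#M. k \<le> x")
    case True
    then show ?thesis by (simp add: pbw_add_min pbw_span_def env.span_zero)
  next
    case False
    define a where "a = Min_mset M"
    have "M \<noteq> {#}" using False by auto
    then have aM: "a \<in># M" and amin: "\<And>x. x \<in># M \<Longrightarrow> a \<le> x" by (simp_all add: a_def)
    have ak: "a < k" using False amin by (meson le_less_trans not_le)
    obtain M' where M: "M = add_mset a M'" using aM by (metis insert_DiffM)
    let ?T = "pbw_span (sum_mset M + k) (size M)"
    let ?g = "\<lambda>k. env_gen (vir_d (- int k))"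
    have T: "env.subspace ?T" by (simp add: pbw_span_def)
    have T_pbw: "pbw N \<in> ?T" if "sum_mset N = sum_mset M + k" "size N \<le> size M" for N
      unfolding pbw_span_def using that by (intro env.span_base) auto
    have sub: "pbw_span s l \<subseteq> ?T" if "s = sum_mset M + k" "l \<le> size M" for s l
      unfolding pbw_span_def using that by (intro env.span_mono) auto
    \<comment> \<open>The central term is absent: it would need \<open>k = - a\<close>, whereas \<open>0 \<le> a < k\<close>.\<close>
    have comm: "?g k * ?g a = ?g a * ?g k + env_scale (of_int (int k - int a)) (?g (k + a))"
      using ak by (subst env_gen_d_commute) (auto simp: algebra_simps)
    define y where "y = ?g k * pbw M' - pbw (add_mset k M')"
    have y: "y \<in> pbw_span (sum_mset M' + k) (size M')"
      using less[of M' k] by (simp add: y_def M)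
    have t1: "?g a * y \<in> ?T"
      using y T unfolding pbw_span_def[of "sum_mset M' + k"]
    proof (rule mult_span_closed)
      fix x assume "x \<in> pbw ` {N. sum_mset N = sum_mset M' + k \<and> size N \<le> size M'}"
      then obtain N where x: "x = pbw N" and N: "sum_mset N = sum_mset M' + k" "size N \<le> size M'"
        by auto
      have "?g a * pbw N - pbw (add_mset a N) \<in> ?T"
        using less[of N a] N sub[of "sum_mset N + a" "size N"] by (auto simp: M add_ac)
      moreover have "pbw (add_mset a N) \<in> ?T" using N by (intro T_pbw) (simp_all add: M)
      ultimately show "?g a * x \<in> ?T"
        using env.subspace_add[OF T] unfolding x by (metis diff_add_cancel)
    qed
    have "?g (k + a) * pbw M' - pbw (add_mset (k + a) M') \<in> ?T"
      using less[of M' "k + a"] sub[of "sum_mset M' + (k + a)" "size M'"] by (auto simp: M add_ac)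
    moreover have "pbw (add_mset (k + a) M') \<in> ?T" by (intro T_pbw) (simp_all add: M)
    ultimately have t2: "?g (k + a) * pbw M' \<in> ?T"
      using env.subspace_add[OF T] by (metis diff_add_cancel)
    have M1: "pbw M = ?g a * pbw M'"
      using amin unfolding M by (intro pbw_add_min) auto
    have M2: "pbw (add_mset k M) = ?g a * pbw (add_mset k M')"
      using amin ak unfolding M by (subst add_mset_commute, intro pbw_add_min) (auto simp: M)
    have "?g k * pbw M = ?g a * (?g k * pbw M') + env_scale (of_int (int k - int a)) (?g (k + a) * pbw M')"
      unfolding M1 mult.assoc[symmetric] comm by (simp add: distrib_right env_scale_mult_left)
    then have "?g k * pbw M - pbw (add_mset k M) =
        ?g a * y + env_scale (of_int (int k - int a)) (?g (k + a) * pbw M')"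
      by (simp add: M2 y_def algebra_simps)
    then show ?thesis
      using t1 t2 T by (simp add: env.subspace_add env.subspace_scale)
  qed
qed

section \<open>The left ideal attached to a type and a central character\<close>

definition whittaker_ideal :: "(vir \<Rightarrow> complex) \<Rightarrow> complex \<Rightarrow> vir_env set" where
  "whittaker_ideal \<psi> \<xi> =
     {a * (env_gen vir_z - env_scale \<xi> 1) +
        (\<Sum>i\<in>I. b i * (env_gen (vir_d i) - env_scale (\<psi> (vir_d i)) 1))
      | (a :: vir_env) (b :: int \<Rightarrow> vir_env) (I :: int set). finite I \<and> I \<subseteq> {0<..}}"

lemma whittaker_idealI:
  assumes "finite I" "I \<subseteq> {0<..}"
    "u = a * (env_gen vir_z - env_scale \<xi> 1) +
       (\<Sum>i\<in>I. b i * (env_gen (vir_d i) - env_scale (\<psi> (vir_d i)) 1))"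
  shows "u \<in> whittaker_ideal \<psi> \<xi>"
  using assms unfolding whittaker_ideal_def by blast

lemma whittaker_idealE:
  assumes "u \<in> whittaker_ideal \<psi> \<xi>"
  obtains a b I where "finite I" "I \<subseteq> {0<..}"
    "u = a * (env_gen vir_z - env_scale \<xi> 1) +
       (\<Sum>i\<in>I. b i * (env_gen (vir_d i) - env_scale (\<psi> (vir_d i)) 1))"
  using assms unfolding whittaker_ideal_def by blast

lemma whittaker_ideal_z: "env_gen vir_z - env_scale \<xi> 1 \<in> whittaker_ideal \<psi> \<xi>"
  by (rule whittaker_idealI[where I = "{}" and a = 1]) auto

lemma whittaker_ideal_d:
  "i > 0 \<Longrightarrow> env_gen (vir_d i) - env_scale (\<psi> (vir_d i)) 1 \<in> whittaker_ideal \<psi> \<xi>"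
  by (rule whittaker_idealI[where I = "{i}" and a = 0 and b = "\<lambda>_. 1"]) auto

lemma whittaker_ideal_mult: 
  assumes "u \<in> whittaker_ideal \<psi> \<xi>"
  shows "r * u \<in> whittaker_ideal \<psi> \<xi>"
proof -
  obtain a b I where "finite I" "I \<subseteq> {0<..}"
    "u = a * (env_gen vir_z - env_scale \<xi> 1) +
       (\<Sum>i\<in>I. b i * (env_gen (vir_d i) - env_scale (\<psi> (vir_d i)) 1))"
    using assms by (rule whittaker_idealE)
  then show ?thesis
    by (intro whittaker_idealI[where I = I and a = "r * a" and b = "\<lambda>i. r * b i"])
       (simp_all add: distrib_left sum_distrib_left mult.assoc)
qed

lemma whittaker_ideal_add:
  assumes "u \<in> whittaker_ideal \<psi> \<xi>" "v \<in> whittaker_ideal \<psi> \<xi>"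
  shows "u + v \<in> whittaker_ideal \<psi> \<xi>"
proof -
  let ?h = "\<lambda>i. env_gen (vir_d i) - env_scale (\<psi> (vir_d i)) 1"
  obtain a b I where u: "finite I" "I \<subseteq> {0<..}"
    "u = a * (env_gen vir_z - env_scale \<xi> 1) + (\<Sum>i\<in>I. b i * ?h i)"
    using assms(1) by (rule whittaker_idealE)
  obtain a' b' I' where v: "finite I'" "I' \<subseteq> {0<..}"
    "v = a' * (env_gen vir_z - env_scale \<xi> 1) + (\<Sum>i\<in>I'. b' i * ?h i)"
    using assms(2) by (rule whittaker_idealE)
  have 1: "(\<Sum>i\<in>I. b i * ?h i) = (\<Sum>i\<in>I\<union>I'. (if i \<in> I then b i else 0) * ?h i)"
    using u v by (intro sum.mono_neutral_cong_left) auto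
  have 2: "(\<Sum>i\<in>I'. b' i * ?h i) = (\<Sum>i\<in>I\<union>I'. (if i \<in> I' then b' i else 0) * ?h i)"
    using u v by (intro sum.mono_neutral_cong_left) auto
  show ?thesis
    using u(1,2) v(1,2) unfolding u(3) v(3) 1 2
    by (intro whittaker_idealI[where I = "I \<union> I'" and a = "a + a'" and
          b = "\<lambda>i. (if i \<in> I then b i else 0) + (if i \<in> I' then b' i else 0)"])
       (simp_all add: distrib_right sum.distrib add_ac)
qed

lemma subspace_whittaker_ideal: "env.subspace (whittaker_ideal \<psi> \<xi>)"
proof (rule env.subspaceI)
  show "0 \<in> whittaker_ideal \<psi> \<xi>"
    using whittaker_ideal_mult[OF whittaker_ideal_z, of 0] by simp
  fix c u assume "u \<in> whittaker_ideal \<psi> \<xi>"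
  then have "env_scale c 1 * u \<in> whittaker_ideal \<psi> \<xi>" by (rule whittaker_ideal_mult)
  then show "env_scale c u \<in> whittaker_ideal \<psi> \<xi>" by (simp add: env_scale_mult_left)
qed (rule whittaker_ideal_add)


section \<open>Elimination of the factors of a monomial\<close>

locale whittaker_type =
  fixes \<psi> :: "vir \<Rightarrow> complex" and \<xi> :: complex
  assumes psi_hom: "vir.hom_to_complex n_plus \<psi>"
    and psi2: "\<psi> (vir_d 2) \<noteq> 0"
begin

abbreviation J :: "vir_env set" where "J \<equiv> whittaker_ideal \<psi> \<xi>"

text \<open>For \<open>n > 0\<close> this element lies in \<open>J\<close>, so modulo \<open>J\<close> left multiplication by it is commutation with it.\<close>

definition lower :: "int \<Rightarrow> vir_env" where
  "lower n = env_gen (vir_d n) - env_scale (\<psi> (vir_d n)) 1"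

text \<open>The estimates below have the form \<open>u \<in> filt P\<close> or \<open>u - v \<in> filt P\<close>, in which \<open>P\<close> describes the monomials that
  count as negligible. A predicate is used instead of a bound on the degree because the natural
  bounds are differences of degrees, which need not exist in pairs of natural numbers.\<close>

definition filt :: "(nat multiset \<Rightarrow> bool) \<Rightarrow> vir_env set" where
  "filt P = env.span (pbw ` Collect P \<union> J)"

text \<open>\<open>\<psi>\<close> vanishes on commutators, and \<open>[d\<^sub>1, d\<^bsub>n-1\<^esub>] = (n - 2) d\<^sub>n\<close>.\<close>

lemma psi_zero:
  assumes "n \<ge> 3"
  shows "\<psi> (vir_d n) = 0"
proof -
  have mem: "vir_d 1 \<in> n_plus" "vir_d (n - 1) \<in> n_plus" "vir_d n \<in> n_plus"
    using assms by (auto intro: vir_d_in_n_plus)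
  have "vir_bracket (vir_d 1) (vir_d (n - 1)) = smult_fs (of_int (n - 2)) (vir_d n)"
    using assms by (simp add: vir_bracket_d_d)
  then have "of_int (n - 2) * \<psi> (vir_d n) = 0"
    using psi_hom mem unfolding vir.hom_to_complex_def by metis
  then show ?thesis using assms by auto
qed

lemma subspace_filt: "env.subspace (filt P)"
  by (simp add: filt_def)

lemmas filt_add = env.subspace_add[OF subspace_filt]
  and filt_scale = env.subspace_scale[OF subspace_filt]
  and filt_diff = env.subspace_diff[OF subspace_filt]
  and filt_zero [simp] = env.subspace_0[OF subspace_filt]

lemma filt_ideal: "u \<in> J \<Longrightarrow> u \<in> filt P"
  unfolding filt_def by (rule env.span_base) simp

lemma filt_pbw: "P M \<Longrightarrow> pbw M \<in> filt P"
  unfolding filt_def by (rule env.span_base) simp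

lemma filt_cong: "u - v \<in> filt P \<Longrightarrow> u \<in> filt P \<longleftrightarrow> v \<in> filt P"
  by (metis diff_add_cancel filt_add filt_diff diff_diff_eq2 add_diff_cancel_left')

lemma filt_weaken: 
  assumes "u \<in> filt P" "\<And>M. P M \<Longrightarrow> Q M"
  shows "u \<in> filt Q"
proof -
  have "filt P \<subseteq> filt Q"
    unfolding filt_def using assms(2) by (intro env.span_mono) auto
  then show ?thesis using assms(1) by blast
qed

lemma filt_mult:
  assumes "u \<in> filt P" "\<And>M. P M \<Longrightarrow> a * pbw M \<in> filt Q"
  shows "a * u \<in> filt Q"
  using assms(1) unfolding filt_def[of P]
  by (rule mult_span_closed[OF _ subspace_filt])
     (use assms(2) in \<open>auto intro: filt_ideal whittaker_ideal_mult\<close>)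

lemma z_mult_pbw: "env_gen vir_z * pbw M - env_scale \<xi> (pbw M) \<in> J"
  using whittaker_ideal_mult[OF whittaker_ideal_z, of "pbw M"]
  by (simp add: pbw_z_central right_diff_distrib env_scale_mult_right)

lemma gen_mult_pbw_filt:
  assumes "\<And>N. sum_mset N = sum_mset M + k \<Longrightarrow> size N \<le> size M \<Longrightarrow> P N"
  shows "env_gen (vir_d (- int k)) * pbw M - pbw (add_mset k M) \<in> filt P"
proof -
  have "pbw_span (sum_mset M + k) (size M) \<subseteq> filt P"
    unfolding pbw_span_def filt_def using assms by (intro env.span_mono) auto
  then show ?thesis using gen_mult_pbw by blast
qed

lemma gen_mult_pbw_in_filt:
  assumes "\<And>N. sum_mset N = sum_mset M + k \<Longrightarrow> size N \<le> size M + 1 \<Longrightarrow> P N"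
  shows "env_gen (vir_d (- int k)) * pbw M \<in> filt P"
  using gen_mult_pbw_filt[of M k P] assms filt_pbw[of P "add_mset k M"] 
  by (subst filt_cong) (simp_all add: add.commute)

lemma gen_eq_lower: "env_gen (vir_d n) * u = lower n * u + env_scale (\<psi> (vir_d n)) u"
  by (simp add: lower_def left_diff_distrib env_scale_mult_left)

text \<open>One step of moving \<open>d\<^sub>n - \<psi>\<^sub>n\<close> to the right, past the first factor of a product.\<close>

lemma lower_mult_gen:
  "lower n * (env_gen (vir_d j) * u) = env_gen (vir_d j) * (lower n * u) +
     env_scale (of_int (j - n)) (env_gen (vir_d (n + j)) * u) +
     (if j = - n then env_scale ((of_int n ^ 3 - of_int n) / 12) (env_gen vir_z * u) else 0)"
proof -
  have "lower n * (env_gen (vir_d j) * u) =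
      (env_gen (vir_d n) * env_gen (vir_d j)) * u - env_scale (\<psi> (vir_d n)) (env_gen (vir_d j) * u)"
    by (simp add: lower_def left_diff_distrib env_scale_mult_left mult.assoc)
  also have "\<dots> = env_gen (vir_d j) * (lower n * u) +
     env_scale (of_int (j - n)) (env_gen (vir_d (n + j)) * u) +
     (if j = - n then env_scale ((of_int n ^ 3 - of_int n) / 12) (env_gen vir_z * u) else 0)"
    unfolding env_gen_d_commute[of n j]
    by (simp add: lower_def left_diff_distrib right_diff_distrib distrib_right env_scale_mult_left
        env_scale_mult_right mult.assoc)
  finally show ?thesis .
qed

text \<open>Here \<open>d\<^sub>1\<close> is treated separately, since no commutator with a factor \<open>d\<^bsub>-k\<^esub>\<close> gives \<open>d\<^sub>2\<close>; what matters is only that the weight does not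
  grow.\<close>

lemma lower_one_pbw: "lower 1 * pbw M \<in> filt (\<lambda>N. sum_mset N \<le> sum_mset M)"
proof (induction M rule: multiset_induct_min)
  case empty
  have "lower 1 \<in> J" unfolding lower_def by (rule whittaker_ideal_d) simp
  then show ?case by (simp add: filt_ideal)
next
  case (add a M)
  let ?F = "filt (\<lambda>N. sum_mset N \<le> sum_mset (add_mset a M))"
  have 1: "env_gen (vir_d (- int a)) * (lower 1 * pbw M) \<in> ?F"
    using add.IH by (rule filt_mult) (auto intro!: gen_mult_pbw_in_filt)
  have 2: "env_gen (vir_d (1 - int a)) * pbw M \<in> ?F"
  proof (cases a)
    case 0
    then show ?thesis using add.IH
      by (auto simp: gen_eq_lower intro!: filt_add filt_scale filt_pbw)
  next
    case (Suc b)
    then show ?thesis using gen_mult_pbw_in_filt[of M b] by simp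
  qed
  have 3: "env_gen vir_z * pbw M \<in> ?F"
    by (subst filt_cong[OF filt_ideal[OF z_mult_pbw]]) (auto intro!: filt_scale filt_pbw)
  have "pbw (add_mset a M) = env_gen (vir_d (- int a)) * pbw M"
    using add.hyps by (intro pbw_add_min) auto
  then show ?case
    using 1 2 3 by (auto simp: lower_mult_gen intro!: filt_add filt_diff filt_scale)
qed

text \<open>The coefficient of \<open>M - {#n#}\<close> in the derivative of \<open>M\<close> with respect to the factor \<open>d\<^bsub>-n\<^esub>\<close>, scaled by the
  constant from \<open>[d\<^bsub>n+2\<^esub>, d\<^bsub>-n\<^esub>] = -(2n+2) d\<^sub>2\<close> and by the value \<open>\<psi>\<^sub>2\<close> of \<open>d\<^sub>2\<close>.\<close>

definition lead :: "nat \<Rightarrow> nat multiset \<Rightarrow> complex" where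
  "lead n M = - (2 * of_nat n + 2) * \<psi> (vir_d 2) * of_nat (count M n)"

lemma lead_zero: "n \<notin># M \<Longrightarrow> lead n M = 0"
  by (simp add: lead_def not_in_iff)

lemma lead_nonzero: "n \<in># M \<Longrightarrow> lead n M \<noteq> 0"
proof -
  have "(2 * of_nat n + 2 :: complex) = of_nat (2 * n + 2)" by simp
  also have "\<dots> \<noteq> 0" by (subst of_nat_eq_0_iff) simp
  finally show "n \<in># M \<Longrightarrow> lead n M \<noteq> 0" 
    using psi2 by (auto simp: lead_def count_eq_zero_iff add_eq_0_iff)
qed

text \<open>The main computation. Moving \<open>d\<^bsub>n+2\<^esub>\<close> past a factor \<open>d\<^bsub>-a\<^esub>\<close> produces \<open>d\<^bsub>n+2-a\<^esub>\<close>. For \<open>a = n\<close> this is \<open>d\<^sub>2\<close>, whose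
  value \<open>\<psi>\<^sub>2\<close> gives the leading term. For \<open>a < n\<close> the index is at least \<open>3\<close>, where \<open>\<psi>\<close> vanishes, so a
  further factor has to be used up: the length drops by at least two while the weight drops by at least \<open>n\<close>.
  For \<open>a > n\<close> the weight drops by more than \<open>n\<close>. The error bound
  \<open>deg (add_mset n N) < deg M\<close> expresses
  that \<open>N\<close> lies strictly below \<open>M - {#n#}\<close> in a form that makes sense also if \<open>n \<notin># M\<close>.\<close>

lemma lower_pbw:
  "lower (int n + 2) * pbw M - env_scale (lead n M) (pbw (M - {#n#}))
     \<in> filt (\<lambda>N. deg (add_mset n N) < deg M)"
proof (induction M arbitrary: n rule: multiset_induct_min)
  case empty
  have "lower (int n + 2) \<in> J" unfolding lower_def by (rule whittaker_ideal_d) simp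
  then show ?case by (auto simp: lead_zero intro: filt_ideal)
next
  case (add a M)
  let ?P = "\<lambda>N. deg (add_mset n N) < deg (add_mset a M)"
  let ?F = "filt ?P"
  let ?g = "\<lambda>k. env_gen (vir_d k)"
  have small: "env_scale (lead m M) (pbw (M - {#m#})) \<in> ?F"
    if "m \<in># M \<Longrightarrow> ?P (M - {#m#})" for m
    using that by (cases "m \<in># M") (auto simp: lead_zero intro!: filt_scale filt_pbw)
  \<comment> \<open>The factor \<open>d\<^bsub>-a\<^esub>\<close> stays, and the operator acts on the rest.\<close>
  have 1: "?g (- int a) * (lower (int n + 2) * pbw M)
      - env_scale (lead n M) (pbw (add_mset a M - {#n#})) \<in> ?F"
  proof -
    define y where "y = lower (int n + 2) * pbw M - env_scale (lead n M) (pbw (M - {#n#}))"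
    have y: "?g (- int a) * y \<in> ?F"
      using add.IH[of n] unfolding y_def[symmetric]
      by (rule filt_mult) (auto intro!: gen_mult_pbw_in_filt simp: deg_def)
    have "env_scale (lead n M) (?g (- int a) * pbw (M - {#n#}) - pbw (add_mset a M - {#n#})) \<in> ?F"
    proof (cases "n \<in># M")
      case True
      then obtain M' where M: "M = add_mset n M'" by (metis insert_DiffM)
      show ?thesis
        using gen_mult_pbw_filt[of M' a ?P] unfolding M
        by (auto simp: deg_def intro!: filt_scale)
    qed (simp add: lead_zero)
    from filt_add[OF y this] show ?thesis
      by (simp add: y_def env_scale_mult_right right_diff_distrib env.scale_right_diff_distrib)
  qed
  \<comment> \<open>The commutator term; only \<open>a = n\<close> contributes to leading order.\<close>
  have 2: "env_scale (of_int (- int a - (int n + 2))) (?g (int n + 2 - int a) * pbw M)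
      - env_scale (if a = n then - (2 * of_nat n + 2) * \<psi> (vir_d 2) else 0) (pbw M) \<in> ?F"
  proof -
    consider "a = n" | "a < n" | "a = n + 1" | "a \<ge> n + 2" by linarith
    then show ?thesis
    proof cases
      case 1
      have "lower 2 * pbw M \<in> ?F"
      proof (subst filt_cong)
        show "lower 2 * pbw M - env_scale (lead 0 M) (pbw (M - {#0#})) \<in> ?F"
          using add.IH[of 0] by (auto elim!: filt_weaken simp: deg_def 1)
        show "env_scale (lead 0 M) (pbw (M - {#0#})) \<in> ?F"
          by (rule small) (auto dest!: multi_member_split simp: deg_def 1)
      qed
      then have "env_scale (- (2 * of_nat n + 2)) (lower 2 * pbw M) \<in> ?F" by (rule filt_scale)
      then show ?thesis 
        using 1 by (simp add: gen_eq_lower[of 2] env.scale_right_distrib algebra_simps)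
    next
      case 2
      then have n: "int n + 2 - int a = int (n - a) + 2" and psi: "\<psi> (vir_d (int n + 2 - int a)) = 0"
        by (auto intro!: psi_zero)
      have "lower (int (n - a) + 2) * pbw M \<in> ?F"
      proof (subst filt_cong)
        show "lower (int (n - a) + 2) * pbw M - env_scale (lead (n - a) M) (pbw (M - {#n - a#})) \<in> ?F"
          using add.IH[of "n - a"] 2 by (auto elim!: filt_weaken simp: deg_def)
        show "env_scale (lead (n - a) M) (pbw (M - {#n - a#})) \<in> ?F"
          using 2 by (intro small) (auto dest!: multi_member_split simp: deg_def)
      qed
      then show ?thesis using 2 psi by (simp add: gen_eq_lower n filt_scale)
    next
      case 3
      have "lower 1 * pbw M \<in> ?F"
        using lower_one_pbw[of M] by (rule filt_weaken) (auto simp: deg_def 3)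
      moreover have "pbw M \<in> ?F" by (rule filt_pbw) (auto simp: deg_def 3)
      ultimately show ?thesis using 3 by (auto simp: gen_eq_lower intro!: filt_add filt_scale)
    next
      case 4
      then have n: "int n + 2 - int a = - int (a - (n + 2))" by simp
      have "?g (int n + 2 - int a) * pbw M \<in> ?F"
        unfolding n using 4 by (intro gen_mult_pbw_in_filt) (auto simp: deg_def)
      then show ?thesis using 4 by (auto intro!: filt_scale)
    qed
  qed
  have 3: "env_gen vir_z * pbw M \<in> ?F" if "a = n + 2"
    by (subst filt_cong[OF filt_ideal[OF z_mult_pbw]]) 
       (auto intro!: filt_scale filt_pbw simp: deg_def that)
  have lead: "env_scale (lead n (add_mset a M)) (pbw (add_mset a M - {#n#})) =
      env_scale (lead n M) (pbw (add_mset a M - {#n#})) +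
      env_scale (if a = n then - (2 * of_nat n + 2) * \<psi> (vir_d 2) else 0) (pbw M)"
  proof (cases "a = n")
    case True
    then show ?thesis
      by (simp add: lead_def env.scale_left_distrib[symmetric] distrib_left add.commute)
  qed (simp add: lead_def)
  have pbw: "pbw (add_mset a M) = ?g (- int a) * pbw M"
    using add.hyps by (intro pbw_add_min) auto
  have z: "(if - int a = - (int n + 2) then env_scale c (env_gen vir_z * pbw M) else 0) \<in> ?F" for c
  proof (cases "a = n + 2")
    case True
    then show ?thesis using 3 by (simp add: filt_scale)
  qed auto
  have idx: "int n + 2 + - int a = int n + 2 - int a" by simp
  show ?case
    using filt_add[OF filt_add[OF 1 2] z]
    unfolding pbw lower_mult_gen lead[symmetric, unfolded pbw] idx
    by (simp add: lead algebra_simps)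
qed

lemma lower_filt:
  assumes "u \<in> filt (\<lambda>N. deg N < deg (add_mset n M))"
  shows "lower (int n + 2) * u \<in> filt (\<lambda>N. deg N < deg M)"
  using assms
proof (rule filt_mult)
  fix N assume N: "deg N < deg (add_mset n M)"
  show "lower (int n + 2) * pbw N \<in> filt (\<lambda>N. deg N < deg M)"
  proof (subst filt_cong)
    show "lower (int n + 2) * pbw N - env_scale (lead n N) (pbw (N - {#n#})) \<in> filt (\<lambda>N. deg N < deg M)"
      using lower_pbw by (rule filt_weaken) (use N in \<open>auto simp: deg_def\<close>)
    show "env_scale (lead n N) (pbw (N - {#n#})) \<in> filt (\<lambda>N. deg N < deg M)"
      using N by (cases "n \<in># N")
        (auto simp: lead_zero deg_def dest!: multi_member_split intro!: filt_scale filt_pbw)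
  qed
qed

lemma filt_sum: "(\<And>i. i \<in> I \<Longrightarrow> f i \<in> filt P) \<Longrightarrow> (\<Sum>i\<in>I. f i) \<in> filt P"
  by (rule env.subspace_sum[OF subspace_filt])

lemma filt_empty:
  assumes "\<And>M. \<not> P M"
  shows "filt P = J"
proof -
  have "Collect P = {}" using assms by simp
  then show ?thesis by (simp only: filt_def image_empty sup_bot_left env.span_eq_iff subspace_whittaker_ideal)
qed

text \<open>Induction on the degree of the leading part. If a factor \<open>d\<^bsub>-n\<^esub>\<close> occurs in one of the leading
  monomials, multiplication by \<open>d\<^bsub>n+2\<^esub> - \<psi>\<^bsub>n+2\<^esub>\<close> yields an element whose leading part is the derivative with respect
  to that factor. Distinct monomials containing \<open>d\<^bsub>-n\<^esub>\<close> stay distinct when one such factor is removed,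
  so the derivative has a nonzero coefficient. The hypothesis speaks of the coefficients of a chosen
  expansion of \<open>u\<close> and not of \<open>u \<notin> J\<close>, since it is the nonvanishing coefficient that is passed on by
  differentiation.\<close>

lemma reach_one_of_leading:
  assumes "finite A" "\<And>M. M \<in> A \<Longrightarrow> deg M = d" "M0 \<in> A" "c M0 \<noteq> 0"
    and "u - (\<Sum>M\<in>A. env_scale (c M) (pbw M)) \<in> filt (\<lambda>N. deg N < d)"
  shows "\<exists>r k. k \<noteq> 0 \<and> r * u - env_scale k 1 \<in> J"
  using assms
proof (induction d arbitrary: A c u M0 rule: less_induct)
  case (less d)
  show ?case
  proof (cases "M0 = {#}")
    case True
    then have d: "d = (0, 0)" using less.prems(2)[OF less.prems(3)] by (simp add: deg_def)
    have "A = {{#}}" using less.prems(2,3) True by (auto simp: deg_def d)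
    moreover have "filt (\<lambda>N. deg N < d) = J" by (rule filt_empty) (simp add: d deg_def)
    ultimately show ?thesis
      using less.prems(4,5) True by (intro exI[of _ 1] exI[of _ "c {#}"]) simp
  next
    case False
    then obtain n M1 where M0: "M0 = add_mset n M1" by (metis multiset_cases)
    have d: "d = deg (add_mset n M1)" using less.prems(2,3) M0 by auto
    let ?F = "filt (\<lambda>N. deg N < deg M1)"
    \<comment> \<open>\<open>B\<close> and \<open>e\<close> describe the derivative of the leading part with respect to \<open>d\<^bsub>-n\<^esub>\<close>.\<close>
    define B where "B = {M. add_mset n M \<in> A}"
    define e where "e M = c (add_mset n M) * lead n (add_mset n M)" for M
    have AB: "add_mset n ` B = {M \<in> A. n \<in># M}"
      by (auto simp: B_def dest: multi_member_split)
    have inj: "inj_on (add_mset n) B" by (simp add: inj_on_def)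
    have finB: "finite B" using less.prems(1) AB inj by (metis finite_imageD finite_Collect_conjI Collect_mem_eq)
    have degB: "deg M = deg M1" if "M \<in> B" for M
      using less.prems(2)[of "add_mset n M"] that by (auto simp: B_def d deg_def)
    have sum: "(\<Sum>M\<in>A. env_scale (c M * lead n M) (pbw (M - {#n#}))) = (\<Sum>M\<in>B. env_scale (e M) (pbw M))"
    proof -
      have "(\<Sum>M\<in>A. env_scale (c M * lead n M) (pbw (M - {#n#}))) =
          (\<Sum>M\<in>add_mset n ` B. env_scale (c M * lead n M) (pbw (M - {#n#})))"
        using less.prems(1) unfolding AB
        by (intro sum.mono_neutral_right) (auto simp: lead_zero)
      then show ?thesis by (simp add: sum.reindex[OF inj] e_def)
    qed
    have "lower (int n + 2) * u - (\<Sum>M\<in>B. env_scale (e M) (pbw M)) =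
        lower (int n + 2) * (u - (\<Sum>M\<in>A. env_scale (c M) (pbw M))) +
        (\<Sum>M\<in>A. env_scale (c M) (lower (int n + 2) * pbw M - env_scale (lead n M) (pbw (M - {#n#}))))"
      unfolding sum[symmetric]
      by (simp add: right_diff_distrib sum_distrib_left env_scale_mult_right sum_subtractf
          env.scale_right_diff_distrib)
    also have "\<dots> \<in> ?F"
    proof (intro filt_add filt_sum filt_scale)
      show "lower (int n + 2) * (u - (\<Sum>M\<in>A. env_scale (c M) (pbw M))) \<in> ?F"
        using less.prems(5) unfolding d by (rule lower_filt)
      fix M assume "M \<in> A"
      then have "deg M = deg (add_mset n M1)" using less.prems(2) d by auto
      then show "lower (int n + 2) * pbw M - env_scale (lead n M) (pbw (M - {#n#})) \<in> ?F"
        by (intro filt_weaken[OF lower_pbw]) (auto simp: deg_def)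
    qed
    finally have "lower (int n + 2) * u - (\<Sum>M\<in>B. env_scale (e M) (pbw M)) \<in> ?F" .
    moreover have "deg M1 < d" by (simp add: d deg_def)
    moreover have "M1 \<in> B" "e M1 \<noteq> 0"
      using less.prems(3,4) lead_nonzero[of n "add_mset n M1"] by (auto simp: B_def e_def M0)
    ultimately obtain r k where "k \<noteq> 0" "r * (lower (int n + 2) * u) - env_scale k 1 \<in> J"
      using less.IH[of "deg M1" B M1 e] finB degB by blast
    then show ?thesis by (metis mult.assoc)
  qed
qed

lemma spanned_by_pbw: "u \<in> filt (\<lambda>_. True)"
proof (induction u rule: env_induct)
  case one
  show ?case using filt_pbw[of "\<lambda>_. True" "{#}"] by simp
next
  case (gen b a)
  show ?case
    using gen
  proof (rule filt_mult)
    fix M :: "nat multiset"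
    show "env_gen (Poly_Mapping.single b 1) * pbw M \<in> filt (\<lambda>_. True)"
    proof (cases b)
      case Cen
      show ?thesis unfolding Cen vir_z_def[symmetric]
        by (subst filt_cong[OF filt_ideal[OF z_mult_pbw]]) (auto intro!: filt_scale filt_pbw)
    next
      case (Dgen j)
      consider "j \<le> 0" | "j = 1" | "j \<ge> 2" by linarith
      then have "env_gen (vir_d j) * pbw M \<in> filt (\<lambda>_. True)"
      proof cases
        case 1
        then show ?thesis using gen_mult_pbw_in_filt[of M "nat (- j)" "\<lambda>_. True"] by simp
      next
        case 2
        then show ?thesis using lower_one_pbw[of M]
          by (auto simp: gen_eq_lower intro!: filt_add filt_scale filt_pbw elim: filt_weaken)
      next
        case 3
        have "lower (int (nat (j - 2)) + 2) * pbw M -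
            env_scale (lead (nat (j - 2)) M) (pbw (M - {#nat (j - 2)#})) \<in> filt (\<lambda>_. True)"
          using lower_pbw by (rule filt_weaken) simp
        then have "lower j * pbw M \<in> filt (\<lambda>_. True)"
          using 3 by (subst (asm) filt_cong[symmetric]) (auto dest: filt_cong intro!: filt_scale filt_pbw)
        then show ?thesis by (auto simp: gen_eq_lower intro!: filt_add filt_scale filt_pbw)
      qed
      then show ?thesis by (simp add: Dgen vir_d_def)
    qed
  qed
qed (auto intro: filt_add filt_scale)

lemma pbw_expansion:
  "\<exists>B c. finite B \<and> u - (\<Sum>M\<in>B. env_scale (c M) (pbw M)) \<in> J"
proof -
  have "u \<in> env.span (range pbw \<union> J)" using spanned_by_pbw[of u] by (simp add: filt_def)
  then show ?thesis
  proof (induction rule: env.span_induct_alt)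
    case base
    show ?case by (intro exI[of _ "{}"]) (simp add: env.subspace_0[OF subspace_whittaker_ideal])
  next
    case (step k x y)
    then obtain B c where B: "finite B" and y: "y - (\<Sum>M\<in>B. env_scale (c M) (pbw M)) \<in> J" by blast
    show ?case
    proof (cases "x \<in> J")
      case True
      have "env_scale k x + (y - (\<Sum>M\<in>B. env_scale (c M) (pbw M))) \<in> J"
        using True y by (intro whittaker_ideal_add env.subspace_scale[OF subspace_whittaker_ideal])
      then show ?thesis using B by (intro exI[of _ B] exI[of _ c]) (simp add: add_diff_eq)
    next
      case False
      then obtain N where x: "x = pbw N" using step.hyps by blast
      define c1 where "c1 M = (if M \<in> B then c M else 0)" for M
      have "(\<Sum>M\<in>insert N B. env_scale (c1 M + (if M = N then k else 0)) (pbw M)) =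
          (\<Sum>M\<in>insert N B. env_scale (c1 M) (pbw M)) +
          (\<Sum>M\<in>insert N B. env_scale (if M = N then k else 0) (pbw M))"
        by (simp only: env.scale_left_distrib sum.distrib)
      also have "(\<Sum>M\<in>insert N B. env_scale (c1 M) (pbw M)) = (\<Sum>M\<in>B. env_scale (c M) (pbw M))"
        using B by (intro sum.mono_neutral_cong_right) (auto simp: c1_def)
      also have "(\<Sum>M\<in>insert N B. env_scale (if M = N then k else 0) (pbw M)) =
          (\<Sum>M\<in>{N}. env_scale k (pbw M))"
        using B by (intro sum.mono_neutral_cong_right) auto
      finally show ?thesis using B y
        by (intro exI[of _ "insert N B"] exI[of _ "\<lambda>M. c1 M + (if M = N then k else 0)"])
           (simp add: x algebra_simps)
    qed
  qed
qed

text \<open>The left ideal \<open>J\<close> is maximal or everything, in the sharp form that a left multiple of \<open>u\<close> can be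
  taken to be a nonzero scalar modulo \<open>J\<close>. In an expansion of \<open>u \<notin> J\<close> into monomials some
  coefficient is nonzero, and the terms of highest degree among those form a leading part.\<close>

lemma reach_one:
  assumes "u \<notin> J"
  shows "\<exists>r k. k \<noteq> 0 \<and> r * u - env_scale k 1 \<in> J"
proof -
  obtain B c where B: "finite B" and u: "u - (\<Sum>M\<in>B. env_scale (c M) (pbw M)) \<in> J"
    using pbw_expansion by blast
  define C where "C = {M \<in> B. c M \<noteq> 0}"
  have finC: "finite C" using B by (simp add: C_def)
  have sumC: "(\<Sum>M\<in>B. env_scale (c M) (pbw M)) = (\<Sum>M\<in>C. env_scale (c M) (pbw M))"
    using B by (intro sum.mono_neutral_right) (auto simp: C_def)
  have "C \<noteq> {}" using assms u unfolding sumC by auto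
  define d where "d = Max (deg ` C)"
  define A where "A = {M \<in> C. deg M = d}"
  have "d \<in> deg ` C" unfolding d_def using finC \<open>C \<noteq> {}\<close> by (intro Max_in) auto
  then obtain M0 where M0: "M0 \<in> A" by (auto simp: A_def)
  have le: "deg M \<le> d" if "M \<in> C" for M using that finC by (simp add: d_def)
  have split: "(\<Sum>M\<in>C. env_scale (c M) (pbw M)) =
      (\<Sum>M\<in>C - A. env_scale (c M) (pbw M)) + (\<Sum>M\<in>A. env_scale (c M) (pbw M))"
    using finC by (intro sum.subset_diff) (auto simp: A_def)
  have "(u - (\<Sum>M\<in>B. env_scale (c M) (pbw M))) + (\<Sum>M\<in>C - A. env_scale (c M) (pbw M))
      \<in> filt (\<lambda>N. deg N < d)"
    using u le by (intro filt_add filt_sum filt_scale filt_pbw filt_ideal)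
      (auto simp: A_def order.strict_iff_order)
  then have "u - (\<Sum>M\<in>A. env_scale (c M) (pbw M)) \<in> filt (\<lambda>N. deg N < d)"
    by (simp add: sumC split)
  then show ?thesis
    using M0 B by (intro reach_one_of_leading[of A d M0 c u]) (auto simp: A_def C_def)
qed

end

section \<open>Whittaker modules\<close>

lemma (in vir_module) env_act_whittaker_ideal:
  assumes "whittaker_vector \<psi> w" "act vir_z w = scale \<xi> w" "u \<in> whittaker_ideal \<psi> \<xi>"
  shows "env_act u w = 0"
proof -
  have zero: "env_act a 0 = 0" for a using env_act_scale_right[of a 0 0] by simp
  have sum: "env_act (\<Sum>i\<in>I. f i) w = (\<Sum>i\<in>I. env_act (f i) w)" for f :: "int \<Rightarrow> vir_env" and I
    using env_act_scale[of 0 0 w] 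
    by (induction I rule: infinite_finite_induct) (simp_all add: env_act_add)
  obtain a b I where "finite I" and I: "I \<subseteq> {0<..}" and u:
    "u = a * (env_gen vir_z - env_scale \<xi> 1) +
       (\<Sum>i\<in>I. b i * (env_gen (vir_d i) - env_scale (\<psi> (vir_d i)) 1))"
    using assms(3) by (rule whittaker_idealE)
  have "env_act (env_gen (vir_d i) - env_scale (\<psi> (vir_d i)) 1) w = 0" if "i \<in> I" for i
    using assms(1) that I vir_d_in_n_plus[of i]
    by (force simp: env_act_diff env_act_scale whittaker_vector_def)
  then show ?thesis
    by (simp add: u env_act_add env_act_mult sum env_act_diff[of "env_gen vir_z"] env_act_scale assms(2) zero)
qed

lemma (in vir_module) env_act_submodule:
  assumes "submodule W" "v \<in> W"
  shows "env_act u v \<in> W"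
proof (induction u rule: env_induct)
  case (gen b a)
  then show ?case using assms(1) by (simp add: env_act_mult submodule_def)
qed (use assms in \<open>auto simp: env_act_add env_act_scale submodule_def subspace_add subspace_scale\<close>)

lemma (in vir_module) submodule_orbit: "submodule (range (\<lambda>u. env_act u w))"
proof -
  have "subspace (range (\<lambda>u. env_act u w))"
  proof (rule subspaceI)
    show "0 \<in> range (\<lambda>u. env_act u w)"
      using env_act_scale[of 0 0 w] by (intro range_eqI[of _ _ "env_scale 0 0"]) simp
  qed (auto simp: env_act_add[symmetric] env_act_scale[symmetric])
  then show ?thesis
    by (auto simp: submodule_def env_act_gen[symmetric] env_act_mult[symmetric] simp del: env_act_gen)
qed

lemma (in vir_module) generates_env_act:
  assumes "generates w"
  obtains u where "v = env_act u w"
proof -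
  have "w \<in> range (\<lambda>u. env_act u w)" by (rule range_eqI[of _ _ 1]) simp
  then have "range (\<lambda>u. env_act u w) = UNIV"
    using assms submodule_orbit by (auto simp: generates_def)
  then show ?thesis using that by auto
qed

text \<open>Applying \<open>reach_one\<close> to the element \<open>u\<close> in a vector \<open>u w\<close> leads back to \<open>w\<close>. This gives simplicity when
  \<open>u w\<close> is a nonzero vector of a submodule, and a contradiction when \<open>u w = 0\<close> with \<open>u\<close> outside the
  ideal.\<close>

theorem proposition4p8:
  fixes \<psi> :: "vir \<Rightarrow> complex"
    and \<xi> :: complex
    and scale :: "complex \<Rightarrow> 'v::ab_group_add \<Rightarrow> 'v"
    and act :: "vir \<Rightarrow> 'v \<Rightarrow> 'v"
  assumes psi_hom: "vir.hom_to_complex n_plus \<psi>"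
    and psi1: "\<psi> (vir_d 1) \<noteq> 0"
    and psi2: "\<psi> (vir_d 2) \<noteq> 0"
    and V_module: "vir_module scale act"
    and V_nonzero: "\<exists>v::'v. v \<noteq> 0"
    and V_whittaker: "vir_module.whittaker_module scale act \<psi>"
    and z_acts: "\<And>v. act vir_z v = scale \<xi> v"
  shows "vir_module.simple scale act \<and>
    (\<forall>w. vir_module.cyclic_whittaker_vector scale act \<psi> w \<longrightarrow>
       vir_module.annihilator scale act w =
         {a * (env_gen vir_z - env_scale \<xi> 1) +
            (\<Sum>i\<in>I. b i * (env_gen (vir_d i) - env_scale (\<psi> (vir_d i)) 1))
          | (a :: vir_env) (b :: int \<Rightarrow> vir_env) (I :: int set). finite I \<and> I \<subseteq> {0<..}})"
proof -
  interpret vir_module scale act by (fact V_module)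
  interpret whittaker_type \<psi> \<xi> using psi_hom psi2 by unfold_locales
  have kill: "env_act u w = 0" if "cyclic_whittaker_vector \<psi> w" "u \<in> J" for u w
    using that env_act_whittaker_ideal[of \<psi> w \<xi> u] z_acts by (simp add: cyclic_whittaker_vector_def)
  have recover: "\<exists>r k. k \<noteq> 0 \<and> env_act r (env_act u w) = scale k w"
    if w: "cyclic_whittaker_vector \<psi> w" and u: "u \<notin> J" for u w
  proof -
    obtain r k where "k \<noteq> 0" "r * u - env_scale k 1 \<in> J" using reach_one[OF u] by blast
    then show ?thesis
      using kill[OF w, of "r * u - env_scale k 1"]
      by (auto simp: env_act_diff env_act_mult env_act_scale)
  qed
  have ann: "annihilator w = J" if w: "cyclic_whittaker_vector \<psi> w" for w
  proof (intro subset_antisym subsetI)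
    fix u assume "u \<in> J"
    then show "u \<in> annihilator w" using kill[OF w] by (simp add: annihilator_def)
  next
    fix u assume u: "u \<in> annihilator w"
    have "w \<noteq> 0"
    proof
      assume "w = 0"
      then have "v = 0" for v :: 'v
        using w generates_env_act[of w v] env_act_scale_right[of _ 0 w]
        by (metis cyclic_whittaker_vector_def scale_zero_left)
      then show False using V_nonzero by blast
    qed
    show "u \<in> J"
    proof (rule ccontr)
      assume "u \<notin> J"
      then obtain r k where "k \<noteq> 0" "env_act r (env_act u w) = scale k w"
        using recover[OF w] by blast
      moreover have "env_act r 0 = 0" using env_act_scale_right[of r 0 0] by simp
      ultimately show False using u \<open>w \<noteq> 0\<close> by (simp add: annihilator_def)
    qed
  qed
  have simple
  proof -
    obtain w where w: "cyclic_whittaker_vector \<psi> w"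
      using V_whittaker by (auto simp: whittaker_module_def)
    have "W = UNIV" if W: "submodule W" and "W \<noteq> {0}" for W
    proof -
      have sub: "subspace W" using W by (simp add: submodule_def)
      then obtain v where v: "v \<in> W" "v \<noteq> 0"
        using \<open>W \<noteq> {0}\<close> subspace_0 by blast
      obtain u where u: "v = env_act u w"
        using w generates_env_act by (metis cyclic_whittaker_vector_def)
      then have "u \<notin> J" using kill[OF w] v by auto
      then obtain r k where k: "k \<noteq> 0" and r: "env_act r v = scale k w"
        using recover[OF w] u by blast
      have "scale (1 / k) (env_act r v) \<in> W"
        using env_act_submodule[OF W v(1)] subspace_scale[OF sub] by blast
      then have "w \<in> W" using k by (simp add: r)
      then show ?thesis using W w by (auto simp: cyclic_whittaker_vector_def generates_def)
    qed
    then show ?thesis using V_nonzero by (auto simp: simple_def)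
  qed
  then show ?thesis using ann by (simp add: whittaker_ideal_def)
qed

end
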